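(* For every set $\Gamma$ of formulas and every formula $\alpha$ of the labelled modal natural deduction system $\mathsf{MS}_{QR}$ described below, $\Gamma \vdash \alpha$ (derivability in $\mathsf{MS}_{QR}$) holds if and only if $\Gamma \vDash \alpha$ (semantic consequence with respect to the frames described below).
   Context: Syntax. Fix a denumerable set of labels $x_0,x_1,\dots$ (metavariables $x,y,z$) and a denumerable set of propositional symbols. Modal formulas (m-formulas) are built from $\bot$ and propositional symbols using $\to$ and two unary modal operators $\Box$ and $\blacksquare$; $\neg A$ abbreviates $A\to\bot$. Relational formulas (r-formulas) are expressions $x\,\mathsf{U}\,y$ and $x\,\mathsf{M}\,y$ with $x,y$ labels. Labelled formulas are $x:A$ with $x$ a label and $A$ an m-formula. A formula is an r-formula or a labelled formula. For a formula $\alpha(x)$ in which label $x$ occurs, $\alpha(y/x)$ denotes the result of replacing every occurrence of $x$ by $y$. Rules of $\mathsf{MS}_{QR}$ (natural deduction, with the standard notion of discharged/open assumptions): ($\to I$) if $x:B$ is derived from the assumption $x:A$, infer $x:A\to B$, discharging $x:A$. ($\to E$) from $x:A\to B$ and $x:A$ infer $x:B$. ($RAA$) if $y:\bot$ (for any label $y$) is derived from the assumption $x:\neg A$, infer $x:A$, discharging $x:\neg A$. ($\bot E$) from $x:\bot$ infer any formula $\alpha$. For each pair $(\bigstar,R)\in\{(\Box,\mathsf{U}),(\blacksquare,\mathsf{M})\}$: ($\bigstar I$) if $y:A$ is derived from the assumption $x\,R\,y$, where $y$ is different from $x$ and does not occur in any open assumption on which $y:A$ depends other than $x\,R\,y$,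 infer $x:\bigstar A$, discharging $x\,R\,y$; ($\bigstar E$) from $x:\bigstar A$ and $x\,R\,y$ infer $y:A$. ($\mathsf{U}$refl) infer $x\,\mathsf{U}\,x$; ($\mathsf{U}$symm) from $x\,\mathsf{U}\,y$ infer $y\,\mathsf{U}\,x$; ($\mathsf{U}$trans) from $x\,\mathsf{U}\,y$ and $y\,\mathsf{U}\,z$ infer $x\,\mathsf{U}\,z$; ($\mathsf{U}I$) from $x\,\mathsf{M}\,y$ infer $x\,\mathsf{U}\,y$. ($\mathsf{M}$ser) if $\alpha$ is derived from the assumption $x\,\mathsf{M}\,y$, where $y$ is different from $x$ and does not occur in $\alpha$ nor in any open assumption on which $\alpha$ depends other than $x\,\mathsf{M}\,y$, infer $\alpha$, discharging $x\,\mathsf{M}\,y$. ($\mathsf{M}$srefl) from $x\,\mathsf{M}\,y$ infer $y\,\mathsf{M}\,y$. ($\mathsf{M}$sub1) from $\alpha(x)$, $x\,\mathsf{M}\,x$ and $x\,\mathsf{M}\,y$ infer $\alpha(y/x)$; ($\mathsf{M}$sub2) from $\alpha(y)$, $x\,\mathsf{M}\,x$ and $x\,\mathsf{M}\,y$ infer $\alpha(x/y)$. $\Gamma\vdash\alpha$ means there is a derivation tree built from these rules ending in $\alpha$ whose open assumptions form a finite subset of $\Gamma$. Semantics. A frame is $\langle W,U,M\rangle$ with $W$ a nonempty set, $U\subseteq W\times W$ an equivalence relation, $M\subseteq W\times W$, satisfying: (i) $vMw\Rightarrow vUw$; (ii) for all $v$ there is $w$ with $vMw$; (iii) $vMw\Rightarrow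 wMw$; (iv) $vMv$ and $vMw$ imply $v=w$. A model adds $V:W\to 2^{\mathrm{Prop}}$. Truth at a world: $w\vDash r$ iff $r\in V(w)$; $w\nvDash\bot$; $w\vDash A\to B$ iff $w\vDash A$ implies $w\vDash B$; $w\vDash\Box A$ iff $w'\vDash A$ for all $w'$ with $wUw'$; $w\vDash\blacksquare A$ iff $w'\vDash A$ for all $w'$ with $wMw'$. An interpretation $\mathscr{I}$ maps labels to worlds; $\mathscr{M},\mathscr{I}\vDash x:A$ iff $\mathscr{M},\mathscr{I}(x)\vDash A$; $\mathscr{M},\mathscr{I}\vDash x\,\mathsf{U}\,y$ iff $\mathscr{I}(x)U\mathscr{I}(y)$; $\mathscr{M},\mathscr{I}\vDash x\,\mathsf{M}\,y$ iff $\mathscr{I}(x)M\mathscr{I}(y)$. $\Gamma\vDash\alpha$ iff for every model $\mathscr{M}$ (over such a frame) and every interpretation $\mathscr{I}$, if $\mathscr{M},\mathscr{I}\vDash\gamma$ for all $\gamma\in\Gamma$ then $\mathscr{M},\mathscr{I}\vDash\alpha$. *)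

theory Defs
  imports Main
begin

section \<open>Syntax\<close>

type_synonym label = nat
type_synonym psym = nat

text \<open>The bold box stands for the operator \<open>\<blacksquare>\<close> associated with \<open>M\<close>.\<close>

datatype mform =
    Bot  ("\<^bold>\<bottom>")
  | Sym psym
  | Imp mform mform  (infixr "\<^bold>\<rightarrow>" 70)
  | Box mform  ("\<box> _" [75] 75)
  | BBox mform  ("\<^bold>\<box> _" [75] 75)

abbreviation Neg :: "mform \<Rightarrow> mform"  ("\<^bold>\<not> _" [75] 75)
  where "\<^bold>\<not> A \<equiv> A \<^bold>\<rightarrow> \<^bold>\<bottom>"

datatype form =
    RelU label label  (infix "\<^bold>U" 60)
  | RelM label label  (infix "\<^bold>M" 60)
  | Lab label mform  (infix "\<^bold>:" 60)

primrec labels :: "form \<Rightarrow> label set" where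
  "labels (x \<^bold>U y) = {x, y}"
| "labels (x \<^bold>M y) = {x, y}"
| "labels (x \<^bold>: A) = {x}"

text \<open>\<open>subst \<alpha> y x\<close> is \<open>\<alpha>(y/x)\<close>: every occurrence of \<open>x\<close> is replaced by \<open>y\<close>.\<close>

definition rename :: "label \<Rightarrow> label \<Rightarrow> label \<Rightarrow> label"
  where "rename y x z = (if z = x then y else z)"

primrec subst :: "form \<Rightarrow> label \<Rightarrow> label \<Rightarrow> form" where
  "subst (u \<^bold>U v) y x = (rename y x u \<^bold>U rename y x v)"
| "subst (u \<^bold>M v) y x = (rename y x u \<^bold>M rename y x v)"
| "subst (u \<^bold>: A) y x = (rename y x u \<^bold>: A)"


section \<open>Natural deduction\<close>

text \<open>\<open>derivation \<Delta> \<alpha>\<close>: some derivation tree ends in \<open>\<alpha>\<close> and has \<open>\<Delta>\<close> as its set of open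
  assumptions. Discharging an assumption closes all of its occurrences (possibly none).\<close>

inductive derivation :: "form set \<Rightarrow> form \<Rightarrow> bool" where
  assumption: "derivation {\<alpha>} \<alpha>"
| ImpI: "derivation \<Delta> (x \<^bold>: B) \<Longrightarrow> derivation (\<Delta> - {x \<^bold>: A}) (x \<^bold>: A \<^bold>\<rightarrow> B)"
| ImpE: "derivation \<Delta>1 (x \<^bold>: A \<^bold>\<rightarrow> B) \<Longrightarrow> derivation \<Delta>2 (x \<^bold>: A)
    \<Longrightarrow> derivation (\<Delta>1 \<union> \<Delta>2) (x \<^bold>: B)"
| RAA: "derivation \<Delta> (y \<^bold>: \<^bold>\<bottom>) \<Longrightarrow> derivation (\<Delta> - {x \<^bold>: \<^bold>\<not> A}) (x \<^bold>: A)"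
| BotE: "derivation \<Delta> (x \<^bold>: \<^bold>\<bottom>) \<Longrightarrow> derivation \<Delta> \<alpha>"
| BoxI: "derivation \<Delta> (y \<^bold>: A) \<Longrightarrow> y \<noteq> x \<Longrightarrow> y \<notin> \<Union> (labels ` (\<Delta> - {x \<^bold>U y}))
    \<Longrightarrow> derivation (\<Delta> - {x \<^bold>U y}) (x \<^bold>: \<box> A)"
| BoxE: "derivation \<Delta>1 (x \<^bold>: \<box> A) \<Longrightarrow> derivation \<Delta>2 (x \<^bold>U y)
    \<Longrightarrow> derivation (\<Delta>1 \<union> \<Delta>2) (y \<^bold>: A)"
| BBoxI: "derivation \<Delta> (y \<^bold>: A) \<Longrightarrow> y \<noteq> x \<Longrightarrow> y \<notin> \<Union> (labels ` (\<Delta> - {x \<^bold>M y}))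
    \<Longrightarrow> derivation (\<Delta> - {x \<^bold>M y}) (x \<^bold>: \<^bold>\<box> A)"
| BBoxE: "derivation \<Delta>1 (x \<^bold>: \<^bold>\<box> A) \<Longrightarrow> derivation \<Delta>2 (x \<^bold>M y)
    \<Longrightarrow> derivation (\<Delta>1 \<union> \<Delta>2) (y \<^bold>: A)"
| Urefl: "derivation {} (x \<^bold>U x)"
| Usymm: "derivation \<Delta> (x \<^bold>U y) \<Longrightarrow> derivation \<Delta> (y \<^bold>U x)"
| Utrans: "derivation \<Delta>1 (x \<^bold>U y) \<Longrightarrow> derivation \<Delta>2 (y \<^bold>U z)
    \<Longrightarrow> derivation (\<Delta>1 \<union> \<Delta>2) (x \<^bold>U z)"
| UI: "derivation \<Delta> (x \<^bold>M y) \<Longrightarrow> derivation \<Delta> (x \<^bold>U y)"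
| Mser: "derivation \<Delta> \<alpha> \<Longrightarrow> y \<noteq> x \<Longrightarrow> y \<notin> labels \<alpha> \<Longrightarrow> y \<notin> \<Union> (labels ` (\<Delta> - {x \<^bold>M y}))
    \<Longrightarrow> derivation (\<Delta> - {x \<^bold>M y}) \<alpha>"
| Msrefl: "derivation \<Delta> (x \<^bold>M y) \<Longrightarrow> derivation \<Delta> (y \<^bold>M y)"
| Msub1: "derivation \<Delta>1 \<alpha> \<Longrightarrow> x \<in> labels \<alpha> \<Longrightarrow> derivation \<Delta>2 (x \<^bold>M x)
    \<Longrightarrow> derivation \<Delta>3 (x \<^bold>M y) \<Longrightarrow> derivation (\<Delta>1 \<union> \<Delta>2 \<union> \<Delta>3) (subst \<alpha> y x)"
| Msub2: "derivation \<Delta>1 \<alpha> \<Longrightarrow> y \<in> labels \<alpha> \<Longrightarrow> derivation \<Delta>2 (x \<^bold>M x)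
    \<Longrightarrow> derivation \<Delta>3 (x \<^bold>M y) \<Longrightarrow> derivation (\<Delta>1 \<union> \<Delta>2 \<union> \<Delta>3) (subst \<alpha> x y)"

definition derivable :: "form set \<Rightarrow> form \<Rightarrow> bool"  (infix "\<turnstile>" 50)
  where "\<Gamma> \<turnstile> \<alpha> \<longleftrightarrow> (\<exists>\<Delta>. finite \<Delta> \<and> \<Delta> \<subseteq> \<Gamma> \<and> derivation \<Delta> \<alpha>)"


section \<open>Semantics\<close>

record 'w frame =
  worlds :: "'w set"
  Urel :: "('w \<times> 'w) set"
  Mrel :: "('w \<times> 'w) set"

record 'w model = "'w frame" +
  val :: "'w \<Rightarrow> psym set"

definition is_frame :: "('w, 'b) frame_scheme \<Rightarrow> bool" where
  "is_frame F \<longleftrightarrow>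
     worlds F \<noteq> {} \<and>
     Urel F \<subseteq> worlds F \<times> worlds F \<and> equiv (worlds F) (Urel F) \<and>
     Mrel F \<subseteq> worlds F \<times> worlds F \<and>
     (\<forall>v w. (v, w) \<in> Mrel F \<longrightarrow> (v, w) \<in> Urel F) \<and>
     (\<forall>v \<in> worlds F. \<exists>w \<in> worlds F. (v, w) \<in> Mrel F) \<and>
     (\<forall>v w. (v, w) \<in> Mrel F \<longrightarrow> (w, w) \<in> Mrel F) \<and>
     (\<forall>v w. (v, v) \<in> Mrel F \<and> (v, w) \<in> Mrel F \<longrightarrow> v = w)"

primrec truth :: "'w model \<Rightarrow> 'w \<Rightarrow> mform \<Rightarrow> bool" where
  "truth \<M> w \<^bold>\<bottom> \<longleftrightarrow> False"
| "truth \<M> w (Sym r) \<longleftrightarrow> r \<in> val \<M> w"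
| "truth \<M> w (A \<^bold>\<rightarrow> B) \<longleftrightarrow> (truth \<M> w A \<longrightarrow> truth \<M> w B)"
| "truth \<M> w (\<box> A) \<longleftrightarrow> (\<forall>w'. (w, w') \<in> Urel \<M> \<longrightarrow> truth \<M> w' A)"
| "truth \<M> w (\<^bold>\<box> A) \<longleftrightarrow> (\<forall>w'. (w, w') \<in> Mrel \<M> \<longrightarrow> truth \<M> w' A)"

definition interpretation_in :: "'w model \<Rightarrow> (label \<Rightarrow> 'w) \<Rightarrow> bool"
  where "interpretation_in \<M> \<I> \<longleftrightarrow> (\<forall>x. \<I> x \<in> worlds \<M>)"

primrec sat :: "'w model \<Rightarrow> (label \<Rightarrow> 'w) \<Rightarrow> form \<Rightarrow> bool" where
  "sat \<M> \<I> (x \<^bold>U y) \<longleftrightarrow> (\<I> x, \<I> y) \<in> Urel \<M>"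
| "sat \<M> \<I> (x \<^bold>M y) \<longleftrightarrow> (\<I> x, \<I> y) \<in> Mrel \<M>"
| "sat \<M> \<I> (x \<^bold>: A) \<longleftrightarrow> truth \<M> (\<I> x) A"

text \<open>Consequence over all models whose set of worlds is any nonempty subset of the type
  \<open>'w\<close>. HOL cannot quantify over all sets of worlds at once, so \<open>'w\<close> is a parameter, to be
  read as an arbitrary infinite type: up to isomorphism every model lives in some such type,
  while over a finite type there would be too few models for completeness.\<close>

definition entails :: "'w itself \<Rightarrow> form set \<Rightarrow> form \<Rightarrow> bool" where
  "entails (_ :: 'w itself) \<Gamma> \<alpha> \<longleftrightarrow>
     (\<forall>(\<M> :: 'w model) \<I>. is_frame \<M> \<longrightarrow> interpretation_in \<M> \<I> \<longrightarrow>
        (\<forall>\<gamma> \<in> \<Gamma>. sat \<M> \<I> \<gamma>) \<longrightarrow> sat \<M> \<I> \<alpha>)"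

abbreviation entails_syntax :: "form set \<Rightarrow> 'w itself \<Rightarrow> form \<Rightarrow> bool"  ("_ \<Turnstile>\<^bsub>_\<^esub> _" [51, 0, 51] 50)
  where "\<Gamma> \<Turnstile>\<^bsub>T\<^esub> \<alpha> \<equiv> entails T \<Gamma> \<alpha>"

end

(* Soundness is rule induction. For completeness, a Henkin construction extends a set that does
   not derive a target formula to a complete one with witnesses; worlds are labels modulo the
   equality "x = y, or x M x and x M y". The target is 0 : Bot or relational. A relational target
   cannot be negated, but labelled assumptions contribute to a relational conclusion only
   through inconsistency, so deciding labelled formulas and adding fresh witnesses keeps it
   underivable. Doubling all labels provides the fresh ones, and halving them undoes this. *)

theory Submission
  imports Defs "HOL-Library.Countable"
begin

section \<open>Soundness\<close>

text \<open>A maximal consistent set in the usual sense is out of reach, since a relational formula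
  has no negation that could be added. It need not be decided either: the canonical relations are
  read off derivability, so a relational formula that the extension does not derive is false in the
  model. Hence the property to preserve at every stage is underivability of the target rather than
  bare consistency. The quotient is forced by frame condition (iv): a world that sees itself sees no
  other world, so the two labels must denote the same world. The rules \<open>Msub1\<close> and
  \<open>Msub2\<close> let all formulas respect this identification, but they replace all
  occurrences of a label together, which costs work wherever a single occurrence has to
  change.\<close>

lemma sat_fun_upd: "y \<notin> labels \<gamma> \<Longrightarrow> sat \<M> (\<I>(y := w)) \<gamma> = sat \<M> \<I> \<gamma>"
  by (cases \<gamma>) auto

lemma sat_subst:
  assumes "\<I> x = \<I> y"
  shows "sat \<M> \<I> (subst \<alpha> y x) = sat \<M> \<I> \<alpha>"
  using assms by (cases \<alpha>) (simp_all add: rename_def)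

lemma interpretation_in_fun_upd:
  "interpretation_in \<M> \<I> \<Longrightarrow> w \<in> worlds \<M> \<Longrightarrow> interpretation_in \<M> (\<I>(y := w))"
  by (auto simp: interpretation_in_def)

lemma derivation_sound:
  assumes "derivation \<Delta> \<alpha>" and fr: "is_frame \<M>"
    and "interpretation_in \<M> \<I>" and "\<forall>\<delta>\<in>\<Delta>. sat \<M> \<I> \<delta>"
  shows "sat \<M> \<I> \<alpha>"
  using assms(1,3,4)
proof (induction arbitrary: \<I> rule: derivation.induct)
  case (assumption \<alpha>)
  then show ?case by simp
next
  case (BotE \<Delta> x \<alpha>)
  from BotE.IH[OF BotE.prems] show ?case by simp
next
  case (BoxE \<Delta>1 x A \<Delta>2 y)
  then have "sat \<M> \<I> (x \<^bold>: \<box> A)" "sat \<M> \<I> (x \<^bold>U y)" by blast+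
  then show ?case by simp
next
  case (BBoxE \<Delta>1 x A \<Delta>2 y)
  then have "sat \<M> \<I> (x \<^bold>: \<^bold>\<box> A)" "sat \<M> \<I> (x \<^bold>M y)" by blast+
  then show ?case by simp
next
  case (ImpI \<Delta> x B A)
  then show ?case by (metis Diff_iff insertE empty_iff sat.simps(3) truth.simps(3))
next
  case (ImpE \<Delta>1 x A B \<Delta>2)
  then show ?case by (metis Un_iff sat.simps(3) truth.simps(3))
next
  case (RAA \<Delta> y x A)
  then show ?case
    by (metis Diff_iff insertE empty_iff sat.simps(3) truth.simps(1) truth.simps(3))
next
  case (BoxI \<Delta> y A x)
  \<comment> \<open>Redirecting the eigenvariable y to an arbitrary successor w makes x U y true;
    the other assumptions do not mention y and keep their truth values.\<close>
  have "truth \<M> w A" if w: "(\<I> x, w) \<in> Urel \<M>" for w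
  proof -
    have "w \<in> worlds \<M>" using w fr by (auto simp: is_frame_def)
    moreover have "sat \<M> (\<I>(y := w)) \<delta>" if "\<delta> \<in> \<Delta>" for \<delta>
      using that BoxI.hyps BoxI.prems w sat_fun_upd[of y \<delta> \<M> \<I> w]
      by (cases "\<delta> = (x \<^bold>U y)") auto
    ultimately have "sat \<M> (\<I>(y := w)) (y \<^bold>: A)"
      by (intro BoxI.IH interpretation_in_fun_upd BoxI.prems(1) ballI)
    then show ?thesis by simp
  qed
  then show ?case by simp
next
  case (BBoxI \<Delta> y A x)
  have "truth \<M> w A" if w: "(\<I> x, w) \<in> Mrel \<M>" for w
  proof -
    have "w \<in> worlds \<M>" using w fr by (auto simp: is_frame_def)
    moreover have "sat \<M> (\<I>(y := w)) \<delta>" if "\<delta> \<in> \<Delta>" for \<delta>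
      using that BBoxI.hyps BBoxI.prems w sat_fun_upd[of y \<delta> \<M> \<I> w]
      by (cases "\<delta> = (x \<^bold>M y)") auto
    ultimately have "sat \<M> (\<I>(y := w)) (y \<^bold>: A)"
      by (intro BBoxI.IH interpretation_in_fun_upd BBoxI.prems(1) ballI)
    then show ?thesis by simp
  qed
  then show ?case by simp
next
  case (Mser \<Delta> \<alpha> y x)
  \<comment> \<open>Seriality of the frame supplies a world to which the eigenvariable can be
    redirected; \<alpha> does not mention y, so its truth carries back to \<I>.\<close>
  obtain w where w: "w \<in> worlds \<M>" "(\<I> x, w) \<in> Mrel \<M>"
    using fr Mser.prems(1) unfolding is_frame_def interpretation_in_def by metis
  have "sat \<M> (\<I>(y := w)) \<delta>" if "\<delta> \<in> \<Delta>" for \<delta>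
    using that Mser.hyps Mser.prems w sat_fun_upd[of y \<delta> \<M> \<I> w]
    by (cases "\<delta> = (x \<^bold>M y)") auto
  then have "sat \<M> (\<I>(y := w)) \<alpha>"
    by (intro Mser.IH interpretation_in_fun_upd Mser.prems(1) w(1) ballI)
  then show ?case using Mser.hyps by (simp add: sat_fun_upd)
next
  case (Urefl x)
  then show ?case using fr
    by (auto simp: is_frame_def interpretation_in_def equiv_def refl_on_def)
next
  case (Usymm \<Delta> x y)
  then have "(\<I> x, \<I> y) \<in> Urel \<M>" by simp
  then show ?case using fr by (auto simp: is_frame_def equiv_def dest: symD)
next
  case (Utrans \<Delta>1 x y \<Delta>2 z)
  then have "(\<I> x, \<I> y) \<in> Urel \<M>" "(\<I> y, \<I> z) \<in> Urel \<M>" by simp_all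
  then show ?case using fr by (auto simp: is_frame_def equiv_def dest: transD)
next
  case (UI \<Delta> x y)
  then show ?case using fr by (auto simp: is_frame_def)
next
  case (Msrefl \<Delta> x y)
  then show ?case using fr unfolding is_frame_def by (metis sat.simps(2))
next
  case (Msub1 \<Delta>1 \<alpha> x \<Delta>2 \<Delta>3 y)
  \<comment> \<open>By frame condition (iv), x M x and x M y make both labels denote one
    world.\<close>
  then have "\<I> x = \<I> y"
    using fr unfolding is_frame_def by (metis UnCI sat.simps(2))
  moreover have "sat \<M> \<I> \<alpha>"
    by (rule Msub1.IH; use Msub1.prems in blast)
  ultimately show ?case by (simp add: sat_subst)
next
  case (Msub2 \<Delta>1 \<alpha> y \<Delta>2 x \<Delta>3)
  then have "\<I> x = \<I> y"
    using fr unfolding is_frame_def by (metis UnCI sat.simps(2))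
  moreover have "sat \<M> \<I> \<alpha>"
    by (rule Msub2.IH; use Msub2.prems in blast)
  ultimately show ?case by (simp add: sat_subst)
qed

lemma soundness: "\<Gamma> \<turnstile> \<alpha> \<Longrightarrow> \<Gamma> \<Turnstile>\<^bsub>TYPE('w)\<^esub> \<alpha>"
  unfolding derivable_def entails_def by (meson derivation_sound subsetD)


section \<open>Derived rules\<close>

text \<open>Finiteness comes for free, so the rules can be restated for arbitrary contexts without
  carrying it along.\<close>

lemma derivation_finite: "derivation \<Delta> \<alpha> \<Longrightarrow> finite \<Delta>"
  by (induction rule: derivation.induct) auto

lemma derivableI: "derivation \<Delta> \<alpha> \<Longrightarrow> \<Delta> \<subseteq> \<Gamma> \<Longrightarrow> \<Gamma> \<turnstile> \<alpha>"
  unfolding derivable_def using derivation_finite by blast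

lemma derivableE:
  assumes "\<Gamma> \<turnstile> \<alpha>"
  obtains \<Delta> where "derivation \<Delta> \<alpha>" "\<Delta> \<subseteq> \<Gamma>" "finite \<Delta>"
  using assms unfolding derivable_def by blast

lemma derivable_mono: "\<Gamma> \<turnstile> \<alpha> \<Longrightarrow> \<Gamma> \<subseteq> \<Gamma>' \<Longrightarrow> \<Gamma>' \<turnstile> \<alpha>"
  unfolding derivable_def by blast

lemma derivable_assm: "\<alpha> \<in> \<Gamma> \<Longrightarrow> \<Gamma> \<turnstile> \<alpha>"
  by (rule derivableI[OF assumption]) simp

lemma derivable_ImpI: "insert (x \<^bold>: A) \<Gamma> \<turnstile> x \<^bold>: B \<Longrightarrow> \<Gamma> \<turnstile> x \<^bold>: A \<^bold>\<rightarrow> B"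
  by (erule derivableE, rule derivableI, erule ImpI) blast

lemma derivable_ImpE: "\<Gamma> \<turnstile> x \<^bold>: A \<^bold>\<rightarrow> B \<Longrightarrow> \<Gamma> \<turnstile> x \<^bold>: A \<Longrightarrow> \<Gamma> \<turnstile> x \<^bold>: B"
  by (elim derivableE, rule derivableI, erule (1) ImpE, blast)

lemma derivable_RAA: "insert (x \<^bold>: \<^bold>\<not> A) \<Gamma> \<turnstile> y \<^bold>: \<^bold>\<bottom> \<Longrightarrow> \<Gamma> \<turnstile> x \<^bold>: A"
  by (erule derivableE, rule derivableI, erule RAA) blast

lemma derivable_BotE: "\<Gamma> \<turnstile> x \<^bold>: \<^bold>\<bottom> \<Longrightarrow> \<Gamma> \<turnstile> \<alpha>"
  by (erule derivableE, rule derivableI, erule BotE)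

lemma derivable_neg: "\<Gamma> \<turnstile> x \<^bold>: \<^bold>\<not> A \<Longrightarrow> \<Gamma> \<turnstile> x \<^bold>: A \<Longrightarrow> \<Gamma> \<turnstile> \<alpha>"
  by (rule derivable_BotE[OF derivable_ImpE])

text \<open>Freshness is asked for all of \<Gamma>, not just for the open assumptions actually used.
  An infinite \<Gamma> may exhaust the labels, so later proofs either pass to finite contexts or
  keep labels in reserve before choosing an eigenvariable.\<close>

lemma derivable_BoxI:
  "insert (x \<^bold>U y) \<Gamma> \<turnstile> y \<^bold>: A \<Longrightarrow> y \<noteq> x \<Longrightarrow> y \<notin> \<Union> (labels ` \<Gamma>) \<Longrightarrow> \<Gamma> \<turnstile> x \<^bold>: \<box> A"
  by (erule derivableE, rule derivableI, erule BoxI) auto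

lemma derivable_BoxE: "\<Gamma> \<turnstile> x \<^bold>: \<box> A \<Longrightarrow> \<Gamma> \<turnstile> x \<^bold>U y \<Longrightarrow> \<Gamma> \<turnstile> y \<^bold>: A"
  by (elim derivableE, rule derivableI, erule (1) BoxE, blast)

lemma derivable_BBoxI:
  "insert (x \<^bold>M y) \<Gamma> \<turnstile> y \<^bold>: A \<Longrightarrow> y \<noteq> x \<Longrightarrow> y \<notin> \<Union> (labels ` \<Gamma>) \<Longrightarrow> \<Gamma> \<turnstile> x \<^bold>: \<^bold>\<box> A"
  by (erule derivableE, rule derivableI, erule BBoxI) auto

lemma derivable_BBoxE: "\<Gamma> \<turnstile> x \<^bold>: \<^bold>\<box> A \<Longrightarrow> \<Gamma> \<turnstile> x \<^bold>M y \<Longrightarrow> \<Gamma> \<turnstile> y \<^bold>: A"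
  by (elim derivableE, rule derivableI, erule (1) BBoxE, blast)

lemma derivable_Urefl: "\<Gamma> \<turnstile> x \<^bold>U x"
  by (rule derivableI[OF Urefl]) simp

lemma derivable_Usymm: "\<Gamma> \<turnstile> x \<^bold>U y \<Longrightarrow> \<Gamma> \<turnstile> y \<^bold>U x"
  by (erule derivableE, rule derivableI, erule Usymm)

lemma derivable_Utrans: "\<Gamma> \<turnstile> x \<^bold>U y \<Longrightarrow> \<Gamma> \<turnstile> y \<^bold>U z \<Longrightarrow> \<Gamma> \<turnstile> x \<^bold>U z"
  by (elim derivableE, rule derivableI, erule (1) Utrans, blast)

lemma derivable_UI: "\<Gamma> \<turnstile> x \<^bold>M y \<Longrightarrow> \<Gamma> \<turnstile> x \<^bold>U y"
  by (erule derivableE, rule derivableI, erule UI)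

lemma derivable_Mser:
  "insert (x \<^bold>M y) \<Gamma> \<turnstile> \<alpha> \<Longrightarrow> y \<noteq> x \<Longrightarrow> y \<notin> labels \<alpha> \<Longrightarrow> y \<notin> \<Union> (labels ` \<Gamma>) \<Longrightarrow> \<Gamma> \<turnstile> \<alpha>"
  by (erule derivableE, rule derivableI, erule Mser) auto

lemma derivable_Msrefl: "\<Gamma> \<turnstile> x \<^bold>M y \<Longrightarrow> \<Gamma> \<turnstile> y \<^bold>M y"
  by (erule derivableE, rule derivableI, erule Msrefl)

lemma derivable_Msub1:
  "\<Gamma> \<turnstile> \<alpha> \<Longrightarrow> x \<in> labels \<alpha> \<Longrightarrow> \<Gamma> \<turnstile> x \<^bold>M x \<Longrightarrow> \<Gamma> \<turnstile> x \<^bold>M y \<Longrightarrow> \<Gamma> \<turnstile> subst \<alpha> y x"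
  by (elim derivableE, rule derivableI, erule (3) Msub1, blast)

lemma derivable_Msub2:
  "\<Gamma> \<turnstile> \<alpha> \<Longrightarrow> y \<in> labels \<alpha> \<Longrightarrow> \<Gamma> \<turnstile> x \<^bold>M x \<Longrightarrow> \<Gamma> \<turnstile> x \<^bold>M y \<Longrightarrow> \<Gamma> \<turnstile> subst \<alpha> x y"
  by (elim derivableE, rule derivableI, erule (3) Msub2, blast)

lemma finite_labels: "finite (labels \<alpha>)"
  by (cases \<alpha>) auto

lemma ex_fresh_label:
  assumes "finite \<Gamma>" "finite S"
  obtains y where "y \<notin> \<Union> (labels ` \<Gamma>)" "y \<notin> S"
proof -
  have "finite (\<Union> (labels ` \<Gamma>) \<union> S)" using assms finite_labels by auto
  then show ?thesis using that ex_new_if_finite infinite_UNIV_nat by (metis Un_iff)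
qed


section \<open>Equality of labels\<close>

text \<open>The substitution rules replace all occurrences of a label at once, so \<open>x M x\<close> cannot be
  turned into \<open>y M x\<close> directly; a fresh \<open>M\<close>-successor \<open>z\<close> of \<open>y\<close>, itself equal to \<open>x\<close>, serves
  as an intermediary.\<close>

lemma derivable_M_sym:
  assumes "\<Gamma> \<turnstile> x \<^bold>M x" "\<Gamma> \<turnstile> x \<^bold>M y"
  shows "\<Gamma> \<turnstile> y \<^bold>M x"
proof (cases "x = y")
  case False
  obtain \<Delta>1 where \<Delta>1: "derivation \<Delta>1 (x \<^bold>M x)" "\<Delta>1 \<subseteq> \<Gamma>" "finite \<Delta>1"
    using assms(1) by (rule derivableE)
  obtain \<Delta>2 where \<Delta>2: "derivation \<Delta>2 (x \<^bold>M y)" "\<Delta>2 \<subseteq> \<Gamma>" "finite \<Delta>2"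
    using assms(2) by (rule derivableE)
  obtain z where z: "z \<notin> \<Union> (labels ` (\<Delta>1 \<union> \<Delta>2))" "z \<notin> {x, y}"
    using ex_fresh_label[of "\<Delta>1 \<union> \<Delta>2" "{x, y}"] \<Delta>1 \<Delta>2 by auto
  let ?\<Delta> = "insert (y \<^bold>M z) (\<Delta>1 \<union> \<Delta>2)"
  have xx: "?\<Delta> \<turnstile> x \<^bold>M x" and xy: "?\<Delta> \<turnstile> x \<^bold>M y"
    using \<Delta>1 \<Delta>2 by (auto intro: derivableI)
  have yz: "?\<Delta> \<turnstile> y \<^bold>M z" by (simp add: derivable_assm)
  have xz: "?\<Delta> \<turnstile> x \<^bold>M z"
    using derivable_Msub2[OF yz _ xx xy] z by (auto simp: rename_def)
  have "?\<Delta> \<turnstile> y \<^bold>M x"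
    using derivable_Msub2[OF yz _ xx xz] z by (auto simp: rename_def split: if_splits)
  then have "\<Delta>1 \<union> \<Delta>2 \<turnstile> y \<^bold>M x"
    using z by (intro derivable_Mser[of y z "\<Delta>1 \<union> \<Delta>2"]) auto
  then show ?thesis using \<Delta>1 \<Delta>2 derivable_mono by blast
qed (use assms in simp)

text \<open>The disjunct \<open>x = y\<close> gives reflexivity at labels for which x M x is not
  derivable.\<close>

definition label_eq :: "form set \<Rightarrow> label \<Rightarrow> label \<Rightarrow> bool" where
  "label_eq \<Gamma> x y \<longleftrightarrow> x = y \<or> \<Gamma> \<turnstile> x \<^bold>M x \<and> \<Gamma> \<turnstile> x \<^bold>M y"

lemma label_eq_refl: "label_eq \<Gamma> x x"
  by (simp add: label_eq_def)

text \<open>The endpoints are changed one after the other by \<open>Msub1\<close>. When they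
  coincide, the rule would change both at once; there the result is read off the equality itself,
  with \<open>derivable_M_sym\<close> for the left endpoint.\<close>

lemma label_eq_M:
  assumes "\<Gamma> \<turnstile> u \<^bold>M v" "label_eq \<Gamma> u u'" "label_eq \<Gamma> v v'"
  shows "\<Gamma> \<turnstile> u' \<^bold>M v'"
proof -
  have left: "\<Gamma> \<turnstile> u' \<^bold>M v"
  proof (cases "u = u' \<or> u = v")
    case True
    then show ?thesis using assms derivable_M_sym by (auto simp: label_eq_def)
  next
    case False
    then show ?thesis using assms(1,2) derivable_Msub1[of \<Gamma> "u \<^bold>M v" u u']
      by (auto simp: label_eq_def rename_def)
  qed
  show ?thesis
  proof (cases "v = v' \<or> u' = v")
    case True
    then show ?thesis using left assms(3) by (auto simp: label_eq_def)
  next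
    case False
    then show ?thesis using left assms(3) derivable_Msub1[of \<Gamma> "u' \<^bold>M v" v v']
      by (auto simp: label_eq_def rename_def)
  qed
qed

lemma label_eq_imp_U: "label_eq \<Gamma> x y \<Longrightarrow> \<Gamma> \<turnstile> x \<^bold>U y"
  by (auto simp: label_eq_def derivable_UI derivable_Urefl)

text \<open>Equal labels are U-related, so symmetry and transitivity of U do here what substitution
  does for M.\<close>

lemma label_eq_U:
  "\<Gamma> \<turnstile> u \<^bold>U v \<Longrightarrow> label_eq \<Gamma> u u' \<Longrightarrow> label_eq \<Gamma> v v' \<Longrightarrow> \<Gamma> \<turnstile> u' \<^bold>U v'"
  using derivable_Utrans[OF derivable_Usymm[OF label_eq_imp_U] derivable_Utrans[OF _ label_eq_imp_U]] .

lemma label_eq_Lab: "\<Gamma> \<turnstile> u \<^bold>: A \<Longrightarrow> label_eq \<Gamma> u u' \<Longrightarrow> \<Gamma> \<turnstile> u' \<^bold>: A"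
  using derivable_Msub1[of \<Gamma> "u \<^bold>: A" u u'] by (auto simp: label_eq_def rename_def)

lemma label_eq_sym: "label_eq \<Gamma> x y \<Longrightarrow> label_eq \<Gamma> y x"
  unfolding label_eq_def using derivable_M_sym[of \<Gamma> x y] derivable_Msrefl[of \<Gamma> x y] by blast

lemma label_eq_trans: "label_eq \<Gamma> x y \<Longrightarrow> label_eq \<Gamma> y z \<Longrightarrow> label_eq \<Gamma> x z"
  using label_eq_M[of \<Gamma> x y x z] label_eq_refl[of \<Gamma> x] by (auto simp: label_eq_def)


section \<open>Relabelling and cut\<close>

primrec relabel :: "(label \<Rightarrow> label) \<Rightarrow> form \<Rightarrow> form" where
  "relabel f (x \<^bold>U y) = (f x \<^bold>U f y)"
| "relabel f (x \<^bold>M y) = (f x \<^bold>M f y)"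
| "relabel f (x \<^bold>: A) = (f x \<^bold>: A)"

lemma relabel_id: "relabel (\<lambda>x. x) \<alpha> = \<alpha>"
  by (cases \<alpha>) auto

lemma relabel_relabel: "relabel f (relabel g \<alpha>) = relabel (\<lambda>x. f (g x)) \<alpha>"
  by (cases \<alpha>) auto

lemma relabel_fun_upd: "y \<notin> labels \<alpha> \<Longrightarrow> relabel (f(y := z)) \<alpha> = relabel f \<alpha>"
  by (cases \<alpha>) auto

lemma labels_relabel: "labels (relabel f \<alpha>) = f ` labels \<alpha>"
  by (cases \<alpha>) auto

text \<open>If f is not injective, a label other than x may also be sent to f x, and then the goal
  is not a substitution instance of \<open>relabel f \<alpha>\<close>. Replacing equals by equals
  one occurrence at a time covers this case.\<close>

lemma derivable_relabel_subst:
  assumes "\<Gamma> \<turnstile> relabel f \<alpha>" "label_eq \<Gamma> (f x) (f y)"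
  shows "\<Gamma> \<turnstile> relabel f (subst \<alpha> y x)"
proof -
  have "label_eq \<Gamma> (f p) (f (rename y x p))" for p
    using assms(2) by (auto simp: rename_def label_eq_refl)
  then show ?thesis using assms(1)
    by (cases \<alpha>) (auto intro: label_eq_M label_eq_U label_eq_Lab)
qed

text \<open>The relabelling need not be injective. Proving relabelling and cut together lets the
  eigenvariables be chosen fresh for the context \<open>\<Gamma>\<close>, which is why that is finite here.\<close>

lemma derivation_relabel_cut_finite:
  assumes "derivation \<Delta> \<alpha>" "finite \<Gamma>" "\<forall>\<delta>\<in>\<Delta>. \<Gamma> \<turnstile> relabel f \<delta>"
  shows "\<Gamma> \<turnstile> relabel f \<alpha>"
  using assms
proof (induction arbitrary: \<Gamma> f rule: derivation.induct)
  case (assumption \<alpha>)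
  then show ?case by blast
next
  case (ImpI \<Delta> x B A)
  have *: "insert (f x \<^bold>: A) \<Gamma> \<turnstile> relabel f \<delta>" if "\<delta> \<in> \<Delta>" for \<delta>
    using that ImpI.prems derivable_mono[of \<Gamma> _ "insert (f x \<^bold>: A) \<Gamma>"]
    by (cases "\<delta> = (x \<^bold>: A)") (auto intro: derivable_assm)
  have "insert (f x \<^bold>: A) \<Gamma> \<turnstile> relabel f (x \<^bold>: B)"
    by (rule ImpI.IH[OF _ ballI[OF *]]) (simp_all add: ImpI.prems)
  then show ?case by (simp add: derivable_ImpI)
next
  case (ImpE \<Delta>1 x A B \<Delta>2)
  then show ?case by (metis UnCI derivable_ImpE relabel.simps(3))
next
  case (RAA \<Delta> y x A)
  have *: "insert (f x \<^bold>: \<^bold>\<not> A) \<Gamma> \<turnstile> relabel f \<delta>" if "\<delta> \<in> \<Delta>" for \<delta>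
    using that RAA.prems derivable_mono[of \<Gamma> _ "insert (f x \<^bold>: \<^bold>\<not> A) \<Gamma>"]
    by (cases "\<delta> = (x \<^bold>: \<^bold>\<not> A)") (auto intro: derivable_assm)
  have "insert (f x \<^bold>: \<^bold>\<not> A) \<Gamma> \<turnstile> relabel f (y \<^bold>: \<^bold>\<bottom>)"
    by (rule RAA.IH[OF _ ballI[OF *]]) (simp_all add: RAA.prems)
  then show ?case by (simp add: derivable_RAA)
next
  case (BotE \<Delta> x \<alpha>)
  then show ?case by (metis derivable_BotE relabel.simps(3))
next
  case (BoxI \<Delta> y A x)
  obtain y' where y': "y' \<notin> \<Union> (labels ` \<Gamma>)" "y' \<notin> {f x}"
    using ex_fresh_label[OF BoxI.prems(1)] by blast
  let ?f = "f(y := y')" and ?\<Gamma> = "insert (f x \<^bold>U y') \<Gamma>"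
  have *: "?\<Gamma> \<turnstile> relabel ?f \<delta>" if "\<delta> \<in> \<Delta>" for \<delta>
  proof (cases "\<delta> = (x \<^bold>U y)")
    case True
    then show ?thesis using BoxI.hyps by (simp add: derivable_assm)
  next
    case False
    then have "relabel ?f \<delta> = relabel f \<delta>" "\<Gamma> \<turnstile> relabel f \<delta>"
      using that BoxI by (auto intro!: relabel_fun_upd)
    then show ?thesis using derivable_mono by (metis subset_insertI)
  qed
  have "?\<Gamma> \<turnstile> relabel ?f (y \<^bold>: A)"
    by (rule BoxI.IH[OF _ ballI[OF *]]) (simp_all add: BoxI.prems)
  then show ?case using y' derivable_BoxI[of "f x" y' \<Gamma> A] by simp
next
  case (BoxE \<Delta>1 x A \<Delta>2 y)
  then show ?case by (metis UnCI derivable_BoxE relabel.simps(1,3))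
next
  case (BBoxI \<Delta> y A x)
  obtain y' where y': "y' \<notin> \<Union> (labels ` \<Gamma>)" "y' \<notin> {f x}"
    using ex_fresh_label[OF BBoxI.prems(1)] by blast
  let ?f = "f(y := y')" and ?\<Gamma> = "insert (f x \<^bold>M y') \<Gamma>"
  have *: "?\<Gamma> \<turnstile> relabel ?f \<delta>" if "\<delta> \<in> \<Delta>" for \<delta>
  proof (cases "\<delta> = (x \<^bold>M y)")
    case True
    then show ?thesis using BBoxI.hyps by (simp add: derivable_assm)
  next
    case False
    then have "relabel ?f \<delta> = relabel f \<delta>" "\<Gamma> \<turnstile> relabel f \<delta>"
      using that BBoxI by (auto intro!: relabel_fun_upd)
    then show ?thesis using derivable_mono by (metis subset_insertI)
  qed
  have "?\<Gamma> \<turnstile> relabel ?f (y \<^bold>: A)"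
    by (rule BBoxI.IH[OF _ ballI[OF *]]) (simp_all add: BBoxI.prems)
  then show ?case using y' derivable_BBoxI[of "f x" y' \<Gamma> A] by simp
next
  case (BBoxE \<Delta>1 x A \<Delta>2 y)
  then show ?case by (metis UnCI derivable_BBoxE relabel.simps(2,3))
next
  case (Urefl x)
  then show ?case by (simp add: derivable_Urefl)
next
  case (Usymm \<Delta> x y)
  then show ?case by (metis derivable_Usymm relabel.simps(1))
next
  case (Utrans \<Delta>1 x y \<Delta>2 z)
  then show ?case by (metis UnCI derivable_Utrans relabel.simps(1))
next
  case (UI \<Delta> x y)
  then show ?case by (metis derivable_UI relabel.simps(1,2))
next
  case (Mser \<Delta> \<alpha> y x)
  obtain y' where y': "y' \<notin> \<Union> (labels ` \<Gamma>)" "y' \<notin> insert (f x) (labels (relabel f \<alpha>))"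
    using ex_fresh_label[OF Mser.prems(1)] finite_labels by (metis finite_insert)
  let ?f = "f(y := y')" and ?\<Gamma> = "insert (f x \<^bold>M y') \<Gamma>"
  have *: "?\<Gamma> \<turnstile> relabel ?f \<delta>" if "\<delta> \<in> \<Delta>" for \<delta>
  proof (cases "\<delta> = (x \<^bold>M y)")
    case True
    then show ?thesis using Mser.hyps by (simp add: derivable_assm)
  next
    case False
    then have "relabel ?f \<delta> = relabel f \<delta>" "\<Gamma> \<turnstile> relabel f \<delta>"
      using that Mser by (auto intro!: relabel_fun_upd)
    then show ?thesis using derivable_mono by (metis subset_insertI)
  qed
  have "?\<Gamma> \<turnstile> relabel ?f \<alpha>"
    by (rule Mser.IH[OF _ ballI[OF *]]) (simp_all add: Mser.prems)
  then have "?\<Gamma> \<turnstile> relabel f \<alpha>" using Mser.hyps by (simp add: relabel_fun_upd)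
  then show ?case using y' derivable_Mser[of "f x" y' \<Gamma>] by simp
next
  case (Msrefl \<Delta> x y)
  then show ?case by (metis derivable_Msrefl relabel.simps(2))
next
  case (Msub1 \<Delta>1 \<alpha> x \<Delta>2 \<Delta>3 y)
  have "\<Gamma> \<turnstile> relabel f \<alpha>" "\<Gamma> \<turnstile> relabel f (x \<^bold>M x)" "\<Gamma> \<turnstile> relabel f (x \<^bold>M y)"
    by (rule Msub1.IH; use Msub1.prems in blast)+
  then show ?case by (simp add: derivable_relabel_subst label_eq_def)
next
  case (Msub2 \<Delta>1 \<alpha> y \<Delta>2 x \<Delta>3)
  have "\<Gamma> \<turnstile> relabel f \<alpha>" "\<Gamma> \<turnstile> relabel f (x \<^bold>M x)" "\<Gamma> \<turnstile> relabel f (x \<^bold>M y)"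
    by (rule Msub2.IH; use Msub2.prems in blast)+
  then have "label_eq \<Gamma> (f x) (f y)" by (simp add: label_eq_def)
  with \<open>\<Gamma> \<turnstile> relabel f \<alpha>\<close> show ?case
    by (rule derivable_relabel_subst[OF _ label_eq_sym])
qed

text \<open>Compactness: the finitely many assumptions used have finite supports in \<Gamma>, and
  the union of these supports is the finite context that the previous lemma requires.\<close>

lemma derivable_relabel_cut:
  assumes "\<Delta> \<turnstile> \<alpha>" "\<And>\<delta>. \<delta> \<in> \<Delta> \<Longrightarrow> \<Gamma> \<turnstile> relabel f \<delta>"
  shows "\<Gamma> \<turnstile> relabel f \<alpha>"
proof -
  obtain \<Delta>' where \<Delta>': "derivation \<Delta>' \<alpha>" "\<Delta>' \<subseteq> \<Delta>" "finite \<Delta>'"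
    using assms(1) by (rule derivableE)
  then have "\<forall>\<delta>\<in>\<Delta>'. \<exists>E. finite E \<and> E \<subseteq> \<Gamma> \<and> derivation E (relabel f \<delta>)"
    using assms(2) by (auto simp: derivable_def)
  then obtain E where E: "\<forall>\<delta>\<in>\<Delta>'. finite (E \<delta>) \<and> E \<delta> \<subseteq> \<Gamma> \<and> derivation (E \<delta>) (relabel f \<delta>)"
    by metis
  have "\<Union> (E ` \<Delta>') \<turnstile> relabel f \<alpha>"
  proof (rule derivation_relabel_cut_finite[OF \<Delta>'(1)])
    show "finite (\<Union> (E ` \<Delta>'))" using E \<Delta>' by auto
    show "\<forall>\<delta>\<in>\<Delta>'. \<Union> (E ` \<Delta>') \<turnstile> relabel f \<delta>" using E by (auto intro: derivableI)
  qed
  then show ?thesis by (rule derivable_mono) (use E in auto)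
qed

text \<open>Implication can internalise \<gamma> only when \<gamma> and \<alpha> are labelled
  formulas at one label; the identity relabelling gives cut for relational formulas and across
  labels as well.\<close>

lemma derivable_cut:
  assumes "insert \<gamma> \<Gamma> \<turnstile> \<alpha>" "\<Gamma> \<turnstile> \<gamma>"
  shows "\<Gamma> \<turnstile> \<alpha>"
proof -
  have "\<Gamma> \<turnstile> relabel (\<lambda>x. x) \<alpha>"
    using assms(1) by (rule derivable_relabel_cut) (use assms(2) in \<open>auto simp: relabel_id derivable_assm\<close>)
  then show ?thesis by (simp add: relabel_id)
qed

lemma derivable_contradiction:
  assumes "insert (x \<^bold>: A) \<Gamma> \<turnstile> y \<^bold>: \<^bold>\<bottom>" "insert (x \<^bold>: \<^bold>\<not> A) \<Gamma> \<turnstile> z \<^bold>: \<^bold>\<bottom>"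
  shows "\<Gamma> \<turnstile> \<alpha>"
  by (rule derivable_BotE[OF derivable_cut[OF assms(1) derivable_RAA[OF assms(2)]]])

section \<open>Relational conclusions\<close>

definition relational :: "form \<Rightarrow> bool" where
  "relational \<alpha> \<longleftrightarrow> (\<forall>x A. \<alpha> \<noteq> (x \<^bold>: A))"

lemma relational_simps [simp]:
  "relational (x \<^bold>U y)" "relational (x \<^bold>M y)" "\<not> relational (x \<^bold>: A)"
  by (auto simp: relational_def)

lemma relational_subst: "relational (subst \<alpha> y x) = relational \<alpha>"
  by (cases \<alpha>) auto

text \<open>Apart from \<open>BotE\<close>, every rule with a relational conclusion has only
  relational premises. A labelled assumption can therefore enter only above a use of
  \<open>BotE\<close>, that is, through a derivation of falsum, which the same rule moves to label
  0.\<close>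

lemma derivation_relational:
  assumes "derivation \<Delta> \<alpha>" "relational \<alpha>"
  shows "{\<delta> \<in> \<Delta>. relational \<delta>} \<turnstile> \<alpha> \<or> \<Delta> \<turnstile> 0 \<^bold>: \<^bold>\<bottom>"
  using assms
proof (induction rule: derivation.induct)
  case (assumption \<alpha>)
  then show ?case by (simp add: derivable_assm)
next
  case (BotE \<Delta> x \<alpha>)
  then show ?case by (meson derivableI derivable_BotE subset_refl)
next
  case (Urefl x)
  then show ?case by (simp add: derivable_Urefl)
next
  case (Usymm \<Delta> x y)
  then show ?case using derivable_Usymm by auto
next
  case (Utrans \<Delta>1 x y \<Delta>2 z)
  show ?case
  proof (cases "\<Delta>1 \<union> \<Delta>2 \<turnstile> 0 \<^bold>: \<^bold>\<bottom>")
    case False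
    then have "\<not> \<Delta>1 \<turnstile> 0 \<^bold>: \<^bold>\<bottom>" "\<not> \<Delta>2 \<turnstile> 0 \<^bold>: \<^bold>\<bottom>"
      using derivable_mono[of _ _ "\<Delta>1 \<union> \<Delta>2"] by auto
    then have *: "{\<delta> \<in> \<Delta>1. relational \<delta>} \<turnstile> x \<^bold>U y" "{\<delta> \<in> \<Delta>2. relational \<delta>} \<turnstile> y \<^bold>U z"
      using Utrans by auto
    have "{\<delta> \<in> \<Delta>1 \<union> \<Delta>2. relational \<delta>} \<turnstile> x \<^bold>U z"
      by (rule derivable_Utrans; rule *[THEN derivable_mono]) auto
    then show ?thesis ..
  qed simp
next
  case (UI \<Delta> x y)
  then show ?case using derivable_UI by auto
next
  case (Mser \<Delta> \<alpha> y x)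
  from Mser.IH[OF Mser.prems] show ?case
  proof
    assume "{\<delta> \<in> \<Delta>. relational \<delta>} \<turnstile> \<alpha>"
    then have "insert (x \<^bold>M y) {\<delta> \<in> \<Delta> - {x \<^bold>M y}. relational \<delta>} \<turnstile> \<alpha>"
      by (rule derivable_mono) auto
    then have "{\<delta> \<in> \<Delta> - {x \<^bold>M y}. relational \<delta>} \<turnstile> \<alpha>"
      by (rule derivable_Mser) (use Mser.hyps in auto)
    then show ?thesis ..
  next
    assume "\<Delta> \<turnstile> 0 \<^bold>: \<^bold>\<bottom>"
    \<comment> \<open>The eigenvariable y may be 0 itself, so falsum first moves to x, which differs
      from y; only then does \<open>Mser\<close> apply.\<close>
    then have "\<Delta> \<turnstile> x \<^bold>: \<^bold>\<bottom>" by (rule derivable_BotE)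
    then have "insert (x \<^bold>M y) (\<Delta> - {x \<^bold>M y}) \<turnstile> x \<^bold>: \<^bold>\<bottom>"
      by (rule derivable_mono) auto
    then have "\<Delta> - {x \<^bold>M y} \<turnstile> x \<^bold>: \<^bold>\<bottom>"
      by (rule derivable_Mser) (use Mser.hyps in auto)
    then show ?thesis using derivable_BotE by blast
  qed
next
  case (Msrefl \<Delta> x y)
  then show ?case using derivable_Msrefl by auto
next
  case (Msub1 \<Delta>1 \<alpha> x \<Delta>2 \<Delta>3 y)
  let ?\<Delta> = "\<Delta>1 \<union> \<Delta>2 \<union> \<Delta>3"
  show ?case
  proof (cases "?\<Delta> \<turnstile> 0 \<^bold>: \<^bold>\<bottom>")
    case False
    then have "\<not> \<Delta>1 \<turnstile> 0 \<^bold>: \<^bold>\<bottom>" "\<not> \<Delta>2 \<turnstile> 0 \<^bold>: \<^bold>\<bottom>" "\<not> \<Delta>3 \<turnstile> 0 \<^bold>: \<^bold>\<bottom>"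
      using derivable_mono[of _ _ ?\<Delta>] by auto
    then have *: "{\<delta> \<in> \<Delta>1. relational \<delta>} \<turnstile> \<alpha>" "{\<delta> \<in> \<Delta>2. relational \<delta>} \<turnstile> x \<^bold>M x"
      "{\<delta> \<in> \<Delta>3. relational \<delta>} \<turnstile> x \<^bold>M y"
      using Msub1 by (auto simp: relational_subst)
    have "{\<delta> \<in> ?\<Delta>. relational \<delta>} \<turnstile> subst \<alpha> y x"
      by (rule derivable_Msub1[OF _ Msub1.hyps(2)]; rule *[THEN derivable_mono]) auto
    then show ?thesis ..
  qed simp
next
  case (Msub2 \<Delta>1 \<alpha> y \<Delta>2 x \<Delta>3)
  let ?\<Delta> = "\<Delta>1 \<union> \<Delta>2 \<union> \<Delta>3"
  show ?case
  proof (cases "?\<Delta> \<turnstile> 0 \<^bold>: \<^bold>\<bottom>")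
    case False
    then have "\<not> \<Delta>1 \<turnstile> 0 \<^bold>: \<^bold>\<bottom>" "\<not> \<Delta>2 \<turnstile> 0 \<^bold>: \<^bold>\<bottom>" "\<not> \<Delta>3 \<turnstile> 0 \<^bold>: \<^bold>\<bottom>"
      using derivable_mono[of _ _ ?\<Delta>] by auto
    then have *: "{\<delta> \<in> \<Delta>1. relational \<delta>} \<turnstile> \<alpha>" "{\<delta> \<in> \<Delta>2. relational \<delta>} \<turnstile> x \<^bold>M x"
      "{\<delta> \<in> \<Delta>3. relational \<delta>} \<turnstile> x \<^bold>M y"
      using Msub2 by (auto simp: relational_subst)
    have "{\<delta> \<in> ?\<Delta>. relational \<delta>} \<turnstile> subst \<alpha> x y"
      by (rule derivable_Msub2[OF _ Msub2.hyps(2)]; rule *[THEN derivable_mono]) auto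
    then show ?thesis ..
  qed simp
qed simp_all

text \<open>Falsum stands in for all labelled conclusions: by \<open>RAA\<close>, an underivable x :
  A means that adding its negation leaves falsum underivable. The label 0 is arbitrary, since
  \<open>BotE\<close> moves falsum to any label.\<close>

definition target :: "form \<Rightarrow> bool" where
  "target \<beta> \<longleftrightarrow> relational \<beta> \<or> \<beta> = (0 \<^bold>: \<^bold>\<bottom>)"

lemma derivable_target:
  assumes "\<Gamma> \<turnstile> \<beta>" "target \<beta>"
  shows "{\<gamma> \<in> \<Gamma>. relational \<gamma>} \<turnstile> \<beta> \<or> \<Gamma> \<turnstile> 0 \<^bold>: \<^bold>\<bottom>"
proof (cases "relational \<beta>")
  case True
  obtain \<Delta> where \<Delta>: "derivation \<Delta> \<beta>" "\<Delta> \<subseteq> \<Gamma>"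
    using assms(1) by (rule derivableE)
  from derivation_relational[OF \<Delta>(1) True] show ?thesis
    by (rule disj_forward; elim derivable_mono) (use \<Delta>(2) in auto)
qed (use assms in \<open>auto simp: target_def\<close>)

text \<open>The new formula is labelled, so the relational part of the enlarged context lies inside
  \<Gamma> and cannot derive \<beta>; only inconsistency remains.\<close>

lemma target_insert_Lab:
  assumes "insert (x \<^bold>: A) \<Gamma> \<turnstile> \<beta>" "target \<beta>" "\<not> \<Gamma> \<turnstile> \<beta>"
  shows "insert (x \<^bold>: A) \<Gamma> \<turnstile> 0 \<^bold>: \<^bold>\<bottom>"
proof -
  have "{\<gamma> \<in> insert (x \<^bold>: A) \<Gamma>. relational \<gamma>} \<subseteq> \<Gamma>" by auto
  then show ?thesis using derivable_target[OF assms(1,2)] assms(3) derivable_mono[of _ \<beta> \<Gamma>] by blast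
qed

text \<open>A derivation from relational assumptions ignores the labelled witness formula, so only x
  U y has to be removed from it. A derivation of falsum yields x : \<box> A by \<open>RAA\<close>
  and \<open>BoxI\<close>, because y is fresh.\<close>

lemma target_Box_witness:
  assumes "target \<beta>" "\<not> \<Gamma> \<turnstile> \<beta>" "\<Gamma> \<turnstile> x \<^bold>: \<^bold>\<not> \<box> A"
    and y: "y \<notin> \<Union> (labels ` \<Gamma>)" "y \<notin> labels \<beta>" "y \<noteq> x"
  shows "\<not> insert (y \<^bold>: \<^bold>\<not> A) (insert (x \<^bold>U y) \<Gamma>) \<turnstile> \<beta>" (is "\<not> ?\<Gamma> \<turnstile> \<beta>")
proof
  assume "?\<Gamma> \<turnstile> \<beta>"
  from derivable_target[OF this assms(1)] show False
  proof
    assume "{\<gamma> \<in> ?\<Gamma>. relational \<gamma>} \<turnstile> \<beta>"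
    then have "insert (x \<^bold>U y) \<Gamma> \<turnstile> \<beta>"
      by (rule derivable_mono) auto
    \<comment> \<open>No rule discharges x U y under a relational conclusion. Collapsing y onto x
      turns it into the derivable x U x and changes nothing else, as y occurs neither in \<Gamma>
      nor in \<beta>.\<close>
    then have "\<Gamma> \<turnstile> relabel ((\<lambda>x. x)(y := x)) \<beta>"
    proof (rule derivable_relabel_cut)
      fix \<delta> assume "\<delta> \<in> insert (x \<^bold>U y) \<Gamma>"
      then show "\<Gamma> \<turnstile> relabel ((\<lambda>x. x)(y := x)) \<delta>"
        using y relabel_fun_upd[of y \<delta> "\<lambda>x. x" x]
        by (auto simp: relabel_id derivable_assm derivable_Urefl)
    qed
    then show False using assms(2) y by (simp add: relabel_fun_upd relabel_id)
  next
    assume "?\<Gamma> \<turnstile> 0 \<^bold>: \<^bold>\<bottom>"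
    then have "\<Gamma> \<turnstile> x \<^bold>: \<box> A"
      using y by (intro derivable_BoxI[OF derivable_RAA])
    then show False using derivable_neg[OF assms(3)] assms(2) by blast
  qed
qed

lemma target_BBox_witness:
  assumes "target \<beta>" "\<not> \<Gamma> \<turnstile> \<beta>" "\<Gamma> \<turnstile> x \<^bold>: \<^bold>\<not> \<^bold>\<box> A"
    and y: "y \<notin> \<Union> (labels ` \<Gamma>)" "y \<notin> labels \<beta>" "y \<noteq> x"
  shows "\<not> insert (y \<^bold>: \<^bold>\<not> A) (insert (x \<^bold>M y) \<Gamma>) \<turnstile> \<beta>" (is "\<not> ?\<Gamma> \<turnstile> \<beta>")
proof
  assume "?\<Gamma> \<turnstile> \<beta>"
  from derivable_target[OF this assms(1)] show False
  proof
    assume "{\<gamma> \<in> ?\<Gamma>. relational \<gamma>} \<turnstile> \<beta>"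
    then have "insert (x \<^bold>M y) \<Gamma> \<turnstile> \<beta>"
      by (rule derivable_mono) auto
    \<comment> \<open>Collapsing y onto x would leave x M x, which is not derivable in general; for
      M, however, seriality discharges the assumption directly.\<close>
    then show False using assms(2) y derivable_Mser[of x y \<Gamma> \<beta>] by blast
  next
    assume "?\<Gamma> \<turnstile> 0 \<^bold>: \<^bold>\<bottom>"
    then have "\<Gamma> \<turnstile> x \<^bold>: \<^bold>\<box> A"
      using y by (intro derivable_BBoxI[OF derivable_RAA])
    then show False using derivable_neg[OF assms(3)] assms(2) by blast
  qed
qed


section \<open>Henkin extension\<close>

instance mform :: countable
  by countable_datatype

text \<open>A refuted box carries its witness, so one enumeration of the pairs both decides formulas
  and supplies witnesses. Only positive membership occurs, which makes the notion stable under
  unions of chains.\<close>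

definition decided :: "form set \<Rightarrow> label \<Rightarrow> mform \<Rightarrow> bool" where
  "decided \<Gamma> x A \<longleftrightarrow> x \<^bold>: A \<in> \<Gamma> \<or>
     x \<^bold>: \<^bold>\<not> A \<in> \<Gamma> \<and>
     (\<forall>B. A = \<box> B \<longrightarrow> (\<exists>y. x \<^bold>U y \<in> \<Gamma> \<and> y \<^bold>: \<^bold>\<not> B \<in> \<Gamma>)) \<and>
     (\<forall>B. A = \<^bold>\<box> B \<longrightarrow> (\<exists>y. x \<^bold>M y \<in> \<Gamma> \<and> y \<^bold>: \<^bold>\<not> B \<in> \<Gamma>))"

lemma decided_mono: "decided \<Gamma> x A \<Longrightarrow> \<Gamma> \<subseteq> \<Gamma>' \<Longrightarrow> decided \<Gamma>' x A"
  by (auto simp: decided_def; blast)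

text \<open>The starting set may be infinite, so finiteness cannot be the invariant that guarantees
  fresh labels; an infinite reserve survives because each step adds finitely many formulas.\<close>

definition extensible :: "form \<Rightarrow> form set \<Rightarrow> bool" where
  "extensible \<beta> \<Gamma> \<longleftrightarrow> \<not> \<Gamma> \<turnstile> \<beta> \<and> infinite (- \<Union> (labels ` \<Gamma>))"

lemma infinite_labels_insert:
  assumes "infinite (- \<Union> (labels ` \<Gamma>))"
  shows "infinite (- \<Union> (labels ` insert \<gamma> \<Gamma>))"
proof -
  have "- \<Union> (labels ` insert \<gamma> \<Gamma>) = - \<Union> (labels ` \<Gamma>) - labels \<gamma>" by auto
  then show ?thesis using assms finite_labels[of \<gamma>] by (metis Diff_infinite_finite)
qed

lemma decide_step:
  assumes "target \<beta>" "extensible \<beta> \<Gamma>"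
  shows "\<exists>\<Gamma>'. \<Gamma> \<subseteq> \<Gamma>' \<and> extensible \<beta> \<Gamma>' \<and> decided \<Gamma>' x A"
proof (cases "insert (x \<^bold>: A) \<Gamma> \<turnstile> \<beta>")
  case False
  then have "extensible \<beta> (insert (x \<^bold>: A) \<Gamma>)"
    using assms(2) infinite_labels_insert by (simp only: extensible_def) blast
  then show ?thesis by (intro exI[of _ "insert (x \<^bold>: A) \<Gamma>"]) (auto simp: decided_def)
next
  case True
  let ?\<Gamma> = "insert (x \<^bold>: \<^bold>\<not> A) \<Gamma>"
  have nb: "\<not> \<Gamma> \<turnstile> \<beta>" using assms(2) by (simp add: extensible_def)
  have inf: "infinite (- \<Union> (labels ` ?\<Gamma>))"
    using assms(2) by (intro infinite_labels_insert) (simp add: extensible_def)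
  \<comment> \<open>If the formula and its negation both led to \<beta>, both would be inconsistent
    with \<Gamma> by \<open>target_insert_Lab\<close>; then \<Gamma> would be inconsistent and
    derive \<beta>.\<close>
  have not: "\<not> ?\<Gamma> \<turnstile> \<beta>"
  proof
    assume "?\<Gamma> \<turnstile> \<beta>"
    then show False
      using derivable_contradiction[OF True[THEN target_insert_Lab] target_insert_Lab] assms(1) nb
      by blast
  qed
  have neg: "?\<Gamma> \<turnstile> x \<^bold>: \<^bold>\<not> A" by (simp add: derivable_assm)
  have "infinite (- \<Union> (labels ` ?\<Gamma>) - (labels \<beta> \<union> {x}))"
    using inf finite_labels by (metis Diff_infinite_finite finite_Un finite.emptyI finite_insert)
  then obtain y where y: "y \<notin> \<Union> (labels ` ?\<Gamma>)" "y \<notin> labels \<beta>" "y \<noteq> x"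
    using infinite_imp_nonempty by blast
  consider (Box) B where "A = \<box> B" | (BBox) B where "A = \<^bold>\<box> B"
    | (other) "\<And>B. A \<noteq> \<box> B" "\<And>B. A \<noteq> \<^bold>\<box> B"
    by blast
  then show ?thesis
  proof cases
    case Box
    let ?\<Gamma>' = "insert (y \<^bold>: \<^bold>\<not> B) (insert (x \<^bold>U y) ?\<Gamma>)"
    have "\<not> ?\<Gamma>' \<turnstile> \<beta>"
      by (rule target_Box_witness[OF assms(1) not _ y]) (use neg Box in simp)
    then have "extensible \<beta> ?\<Gamma>'"
      using inf infinite_labels_insert by (simp only: extensible_def) blast
    then show ?thesis using Box by (intro exI[of _ ?\<Gamma>']) (auto simp: decided_def)
  next
    case BBox
    let ?\<Gamma>' = "insert (y \<^bold>: \<^bold>\<not> B) (insert (x \<^bold>M y) ?\<Gamma>)"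
    have "\<not> ?\<Gamma>' \<turnstile> \<beta>"
      by (rule target_BBox_witness[OF assms(1) not _ y]) (use neg BBox in simp)
    then have "extensible \<beta> ?\<Gamma>'"
      using inf infinite_labels_insert by (simp only: extensible_def) blast
    then show ?thesis using BBox by (intro exI[of _ ?\<Gamma>']) (auto simp: decided_def)
  next
    case other
    have "extensible \<beta> ?\<Gamma>" using not inf unfolding extensible_def by blast
    then show ?thesis using other by (intro exI[of _ ?\<Gamma>]) (auto simp: decided_def)
  qed
qed

lemma finite_subset_UN_chain:
  fixes G :: "nat \<Rightarrow> 'a set"
  assumes "mono G" "finite \<Delta>" "\<Delta> \<subseteq> (\<Union>n. G n)"
  shows "\<exists>n. \<Delta> \<subseteq> G n"
  using assms(2,3)
proof (induction \<Delta>)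
  case (insert a \<Delta>)
  then obtain m n where "\<Delta> \<subseteq> G m" "a \<in> G n" by auto
  then have "insert a \<Delta> \<subseteq> G (max m n)"
    using monoD[OF assms(1), of m "max m n"] monoD[OF assms(1), of n "max m n"] by auto
  then show ?case ..
qed simp

lemma henkin_extension:
  assumes "target \<beta>" "extensible \<beta> \<Gamma>"
  obtains \<Gamma>' where "\<Gamma> \<subseteq> \<Gamma>'" "\<not> \<Gamma>' \<turnstile> \<beta>" "\<And>x A. decided \<Gamma>' x A"
proof -
  \<comment> \<open>Stage n treats the pair coded by n. One visit to each pair suffices, since a
    decision persists in all larger sets.\<close>
  let ?dec = "\<lambda>n :: nat. case from_nat n of (x, A) \<Rightarrow> \<lambda>\<Gamma>. decided \<Gamma> x A"
  have "\<exists>G. \<forall>n. (extensible \<beta> (G n) \<and> \<Gamma> \<subseteq> G n) \<and> (G n \<subseteq> G (Suc n) \<and> ?dec n (G (Suc n)))"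
  proof (rule dependent_nat_choice)
    show "\<exists>G. extensible \<beta> G \<and> \<Gamma> \<subseteq> G" using assms(2) by blast
    fix G n assume "extensible \<beta> G \<and> \<Gamma> \<subseteq> G"
    then show "\<exists>G'. (extensible \<beta> G' \<and> \<Gamma> \<subseteq> G') \<and> (G \<subseteq> G' \<and> ?dec n G')"
      using decide_step[OF assms(1), of G]
      by (cases "from_nat n :: label \<times> mform") (simp, metis order_trans)
  qed
  then obtain G where
    G: "\<forall>n. (extensible \<beta> (G n) \<and> \<Gamma> \<subseteq> G n) \<and> (G n \<subseteq> G (Suc n) \<and> ?dec n (G (Suc n)))" ..
  then have ext: "extensible \<beta> (G n)" and sub: "\<Gamma> \<subseteq> G n"
    and step: "G n \<subseteq> G (Suc n)" and dec: "?dec n (G (Suc n))" for n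
    by simp_all
  have "mono G" using step by (simp add: mono_iff_le_Suc)
  show thesis
  proof
    show "\<Gamma> \<subseteq> (\<Union>n. G n)" using sub by blast
    show "\<not> (\<Union>n. G n) \<turnstile> \<beta>"
    proof
      assume "(\<Union>n. G n) \<turnstile> \<beta>"
      then obtain \<Delta> where "derivation \<Delta> \<beta>" "\<Delta> \<subseteq> (\<Union>n. G n)" "finite \<Delta>"
        by (rule derivableE)
      moreover from this obtain n where "\<Delta> \<subseteq> G n"
        using finite_subset_UN_chain[OF \<open>mono G\<close>] by blast
      ultimately have "G n \<turnstile> \<beta>" by (intro derivableI)
      then show False using ext[of n] by (simp add: extensible_def)
    qed
    fix x A
    have "decided (G (Suc (to_nat (x, A)))) x A" using dec[of "to_nat (x, A)"] by simp
    then show "decided (\<Union>n. G n) x A" by (rule decided_mono) blast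
  qed
qed


section \<open>Canonical model\<close>

lemma canonical_model:
  fixes \<Gamma> :: "form set"
  assumes inf: "infinite (UNIV :: 'w set)"
    and cons: "\<not> \<Gamma> \<turnstile> 0 \<^bold>: \<^bold>\<bottom>" and dec: "\<And>x A. decided \<Gamma> x A"
  obtains \<M> :: "'w model" and \<I> where "is_frame \<M>" "interpretation_in \<M> \<I>"
    "\<And>\<gamma>. sat \<M> \<I> \<gamma> \<longleftrightarrow> \<Gamma> \<turnstile> \<gamma>"
proof -
  obtain e :: "nat \<Rightarrow> 'w" where "inj e"
    using inf infinite_countable_subset by blast
  \<comment> \<open>A class is represented by its least label, and e embeds the representatives into
    \<open>'w\<close>; this is where an infinite \<open>'w\<close> enters.\<close>
  define \<I> where "\<I> x = e (LEAST z. label_eq \<Gamma> x z)" for x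
  have eq: "\<I> x = \<I> y \<longleftrightarrow> label_eq \<Gamma> x y" for x y
  proof
    assume "\<I> x = \<I> y"
    then have "(LEAST z. label_eq \<Gamma> x z) = (LEAST z. label_eq \<Gamma> y z)"
      using \<open>inj e\<close> by (simp add: \<I>_def inj_eq)
    then show "label_eq \<Gamma> x y"
      by (metis LeastI label_eq_refl label_eq_sym label_eq_trans)
  next
    assume "label_eq \<Gamma> x y"
    then have "label_eq \<Gamma> x = label_eq \<Gamma> y"
      using label_eq_sym label_eq_trans by blast
    then show "\<I> x = \<I> y" by (simp add: \<I>_def)
  qed
  define \<M> :: "'w model" where
    "\<M> = \<lparr>worlds = range \<I>, Urel = {(\<I> x, \<I> y) |x y. \<Gamma> \<turnstile> x \<^bold>U y},
          Mrel = {(\<I> x, \<I> y) |x y. \<Gamma> \<turnstile> x \<^bold>M y}, val = \<lambda>w. {r. \<exists>x. w = \<I> x \<and> \<Gamma> \<turnstile> x \<^bold>: Sym r}\<rparr>"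
  have worlds: "worlds \<M> = range \<I>" by (simp add: \<M>_def)
  \<comment> \<open>The relations and the valuation are given through representatives; they are well
    defined because derivability respects \<open>label_eq\<close>.\<close>
  have U: "(\<I> x, \<I> y) \<in> Urel \<M> \<longleftrightarrow> \<Gamma> \<turnstile> x \<^bold>U y" for x y
    by (simp add: \<M>_def eq) (meson label_eq_refl label_eq_sym label_eq_U)
  have M: "(\<I> x, \<I> y) \<in> Mrel \<M> \<longleftrightarrow> \<Gamma> \<turnstile> x \<^bold>M y" for x y
    by (simp add: \<M>_def eq) (meson label_eq_refl label_eq_sym label_eq_M)
  have V: "r \<in> val \<M> (\<I> x) \<longleftrightarrow> \<Gamma> \<turnstile> x \<^bold>: Sym r" for r x
    by (simp add: \<M>_def eq) (meson label_eq_refl label_eq_sym label_eq_Lab)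
  have Usub: "Urel \<M> \<subseteq> range \<I> \<times> range \<I>" and Msub: "Mrel \<M> \<subseteq> range \<I> \<times> range \<I>"
    by (auto simp: \<M>_def)

  have cons': "\<not> \<Gamma> \<turnstile> x \<^bold>: \<^bold>\<bottom>" for x
    using cons derivable_BotE[of \<Gamma> x] by blast
  have neg: "\<Gamma> \<turnstile> x \<^bold>: \<^bold>\<not> A \<longleftrightarrow> \<not> \<Gamma> \<turnstile> x \<^bold>: A" for x A
    using dec[of x A] cons'[of x] derivable_ImpE[of \<Gamma> x A] derivable_assm[of _ \<Gamma>]
    unfolding decided_def by blast
  have witU: "\<exists>y. \<Gamma> \<turnstile> x \<^bold>U y \<and> \<not> \<Gamma> \<turnstile> y \<^bold>: B" if "\<not> \<Gamma> \<turnstile> x \<^bold>: \<box> B" for x B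
    using dec[of x "\<box> B"] that derivable_assm[of _ \<Gamma>] neg unfolding decided_def by (metis (no_types, lifting))
  have witM: "\<exists>y. \<Gamma> \<turnstile> x \<^bold>M y \<and> \<not> \<Gamma> \<turnstile> y \<^bold>: B" if "\<not> \<Gamma> \<turnstile> x \<^bold>: \<^bold>\<box> B" for x B
    using dec[of x "\<^bold>\<box> B"] that derivable_assm[of _ \<Gamma>] neg unfolding decided_def by (metis (no_types, lifting))

  \<comment> \<open>The construction does not add an M-successor for every label outright. But
    \<open>Mser\<close> makes \<open>BBox Bot\<close> contradictory at x, so it is a refuted box,
    and its witness is a successor. The eigenvariable \<open>Suc x\<close> is just some label other
    than x.\<close>
  have serial: "\<exists>y. \<Gamma> \<turnstile> x \<^bold>M y" for x
  proof -
    have "{x \<^bold>: \<^bold>\<box> \<^bold>\<bottom>} \<turnstile> x \<^bold>: \<^bold>\<bottom>"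
    proof (rule derivable_Mser)
      show "insert (x \<^bold>M Suc x) {x \<^bold>: \<^bold>\<box> \<^bold>\<bottom>} \<turnstile> x \<^bold>: \<^bold>\<bottom>"
        by (rule derivable_BotE, rule derivable_BBoxE[of _ x _ "Suc x"]) (auto intro: derivable_assm)
    qed auto
    then have "\<not> \<Gamma> \<turnstile> x \<^bold>: \<^bold>\<box> \<^bold>\<bottom>"
      using cons'[of x] derivable_cut[of _ \<Gamma>] derivable_mono by (metis empty_subsetI insert_mono)
    then show ?thesis using witM by blast
  qed

  have truth: "truth \<M> (\<I> x) A \<longleftrightarrow> \<Gamma> \<turnstile> x \<^bold>: A" for x A
  proof (induction A arbitrary: x)
    case Bot
    then show ?case using cons' by simp
  next
    case (Sym r)
    then show ?case by (simp add: V)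
  next
    case (Imp A B)
    have "\<Gamma> \<turnstile> x \<^bold>: A \<^bold>\<rightarrow> B" if "\<Gamma> \<turnstile> x \<^bold>: B"
      by (rule derivable_ImpI, rule derivable_mono[OF that]) blast
    moreover have "\<Gamma> \<turnstile> x \<^bold>: A \<^bold>\<rightarrow> B" if "\<not> \<Gamma> \<turnstile> x \<^bold>: A"
    proof (rule derivable_ImpI)
      have "\<Gamma> \<turnstile> x \<^bold>: \<^bold>\<not> A" using that neg by blast
      then have "insert (x \<^bold>: A) \<Gamma> \<turnstile> x \<^bold>: \<^bold>\<not> A" by (rule derivable_mono) blast
      then show "insert (x \<^bold>: A) \<Gamma> \<turnstile> x \<^bold>: B"
        by (rule derivable_neg) (simp add: derivable_assm)
    qed
    ultimately show ?case using Imp derivable_ImpE by auto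
  next
    case (Box A)
    \<comment> \<open>Every successor is named by a label, so the quantifier over worlds becomes one
      over labels.\<close>
    have "truth \<M> (\<I> x) (\<box> A) \<longleftrightarrow> (\<forall>y. (\<I> x, \<I> y) \<in> Urel \<M> \<longrightarrow> truth \<M> (\<I> y) A)"
      using Usub by auto
    also have "\<dots> \<longleftrightarrow> (\<forall>y. \<Gamma> \<turnstile> x \<^bold>U y \<longrightarrow> \<Gamma> \<turnstile> y \<^bold>: A)"
      by (simp add: U Box.IH)
    also have "\<dots> \<longleftrightarrow> \<Gamma> \<turnstile> x \<^bold>: \<box> A"
      using witU[of x A] derivable_BoxE[of \<Gamma> x A] by blast
    finally show ?case .
  next
    case (BBox A)
    have "truth \<M> (\<I> x) (\<^bold>\<box> A) \<longleftrightarrow> (\<forall>y. (\<I> x, \<I> y) \<in> Mrel \<M> \<longrightarrow> truth \<M> (\<I> y) A)"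
      using Msub by auto
    also have "\<dots> \<longleftrightarrow> (\<forall>y. \<Gamma> \<turnstile> x \<^bold>M y \<longrightarrow> \<Gamma> \<turnstile> y \<^bold>: A)"
      by (simp add: M BBox.IH)
    also have "\<dots> \<longleftrightarrow> \<Gamma> \<turnstile> x \<^bold>: \<^bold>\<box> A"
      using witM[of x A] derivable_BBoxE[of \<Gamma> x A] by blast
    finally show ?case .
  qed

  show thesis
  proof
    show "interpretation_in \<M> \<I>" by (simp add: interpretation_in_def worlds)
    show "sat \<M> \<I> \<gamma> \<longleftrightarrow> \<Gamma> \<turnstile> \<gamma>" for \<gamma>
      by (cases \<gamma>) (simp_all add: U M truth)
    have "equiv (range \<I>) (Urel \<M>)"
    proof (rule equivI)
      show "refl_on (range \<I>) (Urel \<M>)"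
        by (auto simp: refl_on_def U derivable_Urefl)
      show "sym (Urel \<M>)"
      proof (rule symI)
        fix v w assume "(v, w) \<in> Urel \<M>"
        moreover from this obtain x y where "v = \<I> x" "w = \<I> y" using Usub by blast
        ultimately show "(w, v) \<in> Urel \<M>" by (simp add: U derivable_Usymm)
      qed
      show "trans (Urel \<M>)"
      proof (rule transI)
        fix u v w assume "(u, v) \<in> Urel \<M>" "(v, w) \<in> Urel \<M>"
        moreover from this obtain x y z where "u = \<I> x" "v = \<I> y" "w = \<I> z" using Usub by blast
        ultimately show "(u, w) \<in> Urel \<M>" by (auto simp: U intro: derivable_Utrans)
      qed
    qed (rule Usub)
    \<comment> \<open>Condition (iv) holds by construction: x M x and x M y are exactly the second
      disjunct of \<open>label_eq\<close>, so the two classes coincide.\<close>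
    moreover have "(v, w) \<in> Urel \<M> \<and> (w, w) \<in> Mrel \<M> \<and> ((v, v) \<in> Mrel \<M> \<longrightarrow> v = w)"
      if vw: "(v, w) \<in> Mrel \<M>" for v w
    proof -
      obtain x y where "v = \<I> x" "w = \<I> y" using Msub vw by blast
      then show ?thesis using vw
        by (auto simp: U M eq label_eq_def intro: derivable_UI derivable_Msrefl)
    qed
    moreover have "\<exists>w\<in>range \<I>. (v, w) \<in> Mrel \<M>" if "v \<in> range \<I>" for v
      using that serial M by blast
    ultimately show "is_frame \<M>"
      using Usub Msub by (auto simp: is_frame_def worlds)
  qed
qed


section \<open>Completeness\<close>

lemma sat_relabel: "sat \<M> \<I> (relabel f \<gamma>) \<longleftrightarrow> sat \<M> (\<I> \<circ> f) \<gamma>"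
  by (cases \<gamma>) auto

lemma target_countermodel:
  fixes \<Gamma> :: "form set"
  assumes inf: "infinite (UNIV :: 'w set)" and "target \<beta>" "\<not> \<Gamma> \<turnstile> \<beta>"
  obtains \<M> :: "'w model" and \<I> where "is_frame \<M>" "interpretation_in \<M> \<I>"
    "\<forall>\<gamma>\<in>\<Gamma>. sat \<M> \<I> \<gamma>" "\<not> sat \<M> \<I> \<beta>"
proof -
  let ?r = "relabel (\<lambda>x. 2 * x)"
  have half: "relabel (\<lambda>x. x div 2) (?r \<gamma>) = \<gamma>" for \<gamma>
    by (simp add: relabel_relabel relabel_id)
  have "target (?r \<beta>)"
    using assms(2) by (cases \<beta>) (auto simp: target_def)
  \<comment> \<open>A derivation from the doubled set may pass through odd labels, which halving
    merges with even ones; hence relabelling had to be proved for maps that are not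
    injective.\<close>
  have "\<not> ?r ` \<Gamma> \<turnstile> ?r \<beta>"
  proof
    assume "?r ` \<Gamma> \<turnstile> ?r \<beta>"
    then have "\<Gamma> \<turnstile> relabel (\<lambda>x. x div 2) (?r \<beta>)"
      by (rule derivable_relabel_cut) (auto simp: half derivable_assm)
    then show False using assms(3) by (simp add: half)
  qed
  moreover have "infinite (- \<Union> (labels ` ?r ` \<Gamma>))"
  proof -
    have "Suc (2 * n) \<notin> \<Union> (labels ` ?r ` \<Gamma>)" for n
    proof
      assume "Suc (2 * n) \<in> \<Union> (labels ` ?r ` \<Gamma>)"
      then obtain k where "Suc (2 * n) = 2 * k" by (auto simp: labels_relabel)
      then show False by presburger
    qed
    then have "range (\<lambda>n. Suc (2 * n)) \<subseteq> - \<Union> (labels ` ?r ` \<Gamma>)" by blast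
    moreover have "infinite (range (\<lambda>n. Suc (2 * n)))"
      by (auto simp: inj_on_def dest!: finite_imageD)
    ultimately show ?thesis using finite_subset by blast
  qed
  ultimately have "extensible (?r \<beta>) (?r ` \<Gamma>)" by (simp add: extensible_def)
  then obtain \<Gamma>' where \<Gamma>': "?r ` \<Gamma> \<subseteq> \<Gamma>'" "\<not> \<Gamma>' \<turnstile> ?r \<beta>" "\<And>x A. decided \<Gamma>' x A"
    using henkin_extension[OF \<open>target (?r \<beta>)\<close>] by blast
  then have "\<not> \<Gamma>' \<turnstile> 0 \<^bold>: \<^bold>\<bottom>" using derivable_BotE[of \<Gamma>' 0] by blast
  then obtain \<M> :: "'w model" and \<I> where \<M>: "is_frame \<M>" "interpretation_in \<M> \<I>"
    "\<And>\<gamma>. sat \<M> \<I> \<gamma> \<longleftrightarrow> \<Gamma>' \<turnstile> \<gamma>"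
    using canonical_model[OF inf, of \<Gamma>'] \<Gamma>'(3) by blast
  show thesis
  proof
    show "is_frame \<M>" by (fact \<M>)
    show "interpretation_in \<M> (\<I> \<circ> (\<lambda>x. 2 * x))"
      using \<M>(2) by (simp add: interpretation_in_def)
    show "\<forall>\<gamma>\<in>\<Gamma>. sat \<M> (\<I> \<circ> (\<lambda>x. 2 * x)) \<gamma>"
      using \<Gamma>'(1) by (auto simp: sat_relabel[symmetric] \<M>(3) intro: derivable_assm)
    show "\<not> sat \<M> (\<I> \<circ> (\<lambda>x. 2 * x)) \<beta>"
      using \<Gamma>'(2) by (simp add: sat_relabel[symmetric] \<M>(3))
  qed
qed

lemma completeness:
  fixes \<Gamma> :: "form set" and \<alpha> :: form
  assumes inf: "infinite (UNIV :: 'w set)" and ent: "\<Gamma> \<Turnstile>\<^bsub>TYPE('w)\<^esub> \<alpha>"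
  shows "\<Gamma> \<turnstile> \<alpha>"
proof (rule ccontr)
  assume not: "\<not> \<Gamma> \<turnstile> \<alpha>"
  show False
  proof (cases "relational \<alpha>")
    case True
    then have "target \<alpha>" by (simp add: target_def)
    from target_countermodel[OF inf this not] show False
      using ent unfolding entails_def by metis
  next
    case False
    then obtain x A where \<alpha>: "\<alpha> = (x \<^bold>: A)" by (auto simp: relational_def)
    have "target (0 \<^bold>: \<^bold>\<bottom>)" by (simp add: target_def)
    \<comment> \<open>A labelled conclusion is refuted by adding its negation and aiming at falsum;
      \<open>RAA\<close> shows that falsum stays underivable.\<close>
    moreover have "\<not> insert (x \<^bold>: \<^bold>\<not> A) \<Gamma> \<turnstile> 0 \<^bold>: \<^bold>\<bottom>"
      using not derivable_RAA[of x A \<Gamma> 0] unfolding \<alpha> by blast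
    ultimately obtain \<M> :: "'w model" and \<I> where "is_frame \<M>" "interpretation_in \<M> \<I>"
      "\<forall>\<gamma>\<in>insert (x \<^bold>: \<^bold>\<not> A) \<Gamma>. sat \<M> \<I> \<gamma>"
      using target_countermodel[OF inf] by metis
    then show False using ent unfolding entails_def \<alpha> by auto
  qed
qed

theorem mainTheorem1:
  fixes \<Gamma> :: "form set" and \<alpha> :: form
  assumes "infinite (UNIV :: 'w set)"
  shows "\<Gamma> \<turnstile> \<alpha> \<longleftrightarrow> \<Gamma> \<Turnstile>\<^bsub>TYPE('w)\<^esub> \<alpha>"
  using soundness completeness[OF assms] by blast

end
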